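(* Let $G=(V,E)$ be a finite split graph. Then for every integral weight function $w:V\to\mathbb{N}$ one has $\gamma_w(G)=\gamma^i_w(G)$.
   Context: All graphs are finite and simple, and $\mathbb{N}=\{0,1,2,\dots\}$. A graph is a split graph if its vertex set is the disjoint union of a clique and an independent set. For a vertex $v$ of a graph $G=(V,E)$, $N(v)$ denotes the closed neighborhood of $v$, i.e. $v$ together with all vertices adjacent to $v$. For a real valued function $f$ on $V$ and $A\subseteq V$, write $f[A]=\sum_{a\in A}f(a)$, and $|f|=f[V]$ is called the size of $f$. Given $w:V\to\mathbb{N}$, a nonnegative function $f$ on $V$ $w$-dominates a set $U\subseteq V$ if $f[N(u)]\ge w(u)$ for every $u\in U$; it is $w$-dominating if it $w$-dominates $V$. The weighted domination number $\gamma_w(G)$ is the minimal size $|f|$ of an integer valued nonnegative $w$-dominating function $f:V\to\mathbb{N}$. The (weighted) independent domination number $\gamma^i_w(G)$ is the maximum, over all independent sets $I\subseteq V$, of the minimal size $|f|$ of an integer valued nonnegative function $f:V\to\mathbb{N}$ that $w$-dominates $I$. *)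

theory Defs
  imports "Graph_Theory.Digraph"
begin

(* A finite simple graph is a pre_digraph satisfying the locale predicate "graph":
   finite, loop-free, without parallel arcs, and symmetric. An undirected edge uv is
   the pair of arcs u -> v, v -> u. The arrow notation is the adjacency relation. *)

definition clique :: "('a, 'b) pre_digraph \<Rightarrow> 'a set \<Rightarrow> bool" where
  "clique G K \<longleftrightarrow> K \<subseteq> verts G \<and> (\<forall>u\<in>K. \<forall>v\<in>K. u \<noteq> v \<longrightarrow> u \<rightarrow>\<^bsub>G\<^esub> v)"

definition independent_set :: "('a, 'b) pre_digraph \<Rightarrow> 'a set \<Rightarrow> bool" where
  "independent_set G I \<longleftrightarrow> I \<subseteq> verts G \<and> (\<forall>u\<in>I. \<forall>v\<in>I. \<not> u \<rightarrow>\<^bsub>G\<^esub> v)"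

definition split_graph :: "('a, 'b) pre_digraph \<Rightarrow> bool" where
  "split_graph G \<longleftrightarrow>
     (\<exists>K I. verts G = K \<union> I \<and> K \<inter> I = {} \<and> clique G K \<and> independent_set G I)"

definition closed_nbhd :: "('a, 'b) pre_digraph \<Rightarrow> 'a \<Rightarrow> 'a set" where
  "closed_nbhd G v = insert v {u \<in> verts G. v \<rightarrow>\<^bsub>G\<^esub> u}"

(* Polymorphic in the value type of f, so that it covers both real-valued functions and,
   as used in the domination numbers below, natural-number-valued ones (for which the
   nonnegativity condition is vacuous and of_nat is the identity). *)
definition w_dominates ::
    "('a, 'b) pre_digraph \<Rightarrow> ('a \<Rightarrow> nat) \<Rightarrow> ('a \<Rightarrow> 'c :: linordered_semidom) \<Rightarrow> 'a set \<Rightarrow> bool" where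
  "w_dominates G w f U \<longleftrightarrow>
     (\<forall>v\<in>verts G. 0 \<le> f v) \<and> (\<forall>u\<in>U. of_nat (w u) \<le> sum f (closed_nbhd G u))"

(* Values of f outside verts G are irrelevant when U is contained in verts G. *)
definition min_dom_size :: "('a, 'b) pre_digraph \<Rightarrow> ('a \<Rightarrow> nat) \<Rightarrow> 'a set \<Rightarrow> nat" where
  "min_dom_size G w U =
     (LEAST n. \<exists>f :: 'a \<Rightarrow> nat. w_dominates G w f U \<and> sum f (verts G) = n)"

definition weighted_domination_number :: "('a, 'b) pre_digraph \<Rightarrow> ('a \<Rightarrow> nat) \<Rightarrow> nat" where
  "weighted_domination_number G w = min_dom_size G w (verts G)"

definition independent_domination_number :: "('a, 'b) pre_digraph \<Rightarrow> ('a \<Rightarrow> nat) \<Rightarrow> nat" where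
  "independent_domination_number G w = Max {min_dom_size G w I | I. independent_set G I}"

(* The minimum and the maximum above are over nonempty sets, the latter being finite. *)

lemma (in graph) min_dom_size_attained:
  obtains f :: "'a \<Rightarrow> nat"
  where "w_dominates G w f U" and "sum f (verts G) = min_dom_size G w U"
proof -
  have fin: "finite (closed_nbhd G u)" for u
    by (simp add: closed_nbhd_def)
  have "w_dominates G w w U"
    unfolding w_dominates_def
    by (auto intro!: member_le_sum fin simp: closed_nbhd_def)
  hence "\<exists>n. \<exists>f :: 'a \<Rightarrow> nat. w_dominates G w f U \<and> sum f (verts G) = n"
    by blast
  from LeastI_ex[OF this] show ?thesis
    using that unfolding min_dom_size_def by blast
qed

lemma (in graph) finite_independent_sizes:
  "finite {min_dom_size G w I | I. independent_set G I}"
proof -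
  have "{min_dom_size G w I | I. independent_set G I} \<subseteq> min_dom_size G w ` Pow (verts G)"
    by (auto simp: independent_set_def)
  thus ?thesis
    by (rule finite_subset) simp
qed

lemma independent_sizes_nonempty:
  "{min_dom_size G w I | I. independent_set G I} \<noteq> {}"
  by (auto simp: independent_set_def intro: exI[of _ "{}"])

end

theory Submission
  imports Defs
begin

text \<open>
  Only \<open>\<gamma>\<^sub>w \<le> \<gamma>\<^sup>i\<^sub>w\<close> needs an argument, since dominating all vertices is at
  least as expensive as dominating an independent set. If the clique is empty, the whole vertex set is
  independent. Otherwise, let \<open>V = K \<union> I\<close> with
  \<open>K\<close> a nonempty clique and \<open>I\<close> independent, let \<open>Z \<subseteq> I\<close> be the set of isolated vertices in \<open>I\<close>, let \<open>s\<close> be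
  the minimal cost of dominating \<open>I\<close>, and let \<open>M = w(k)\<close> be the largest weight on \<open>K\<close>. The
  proof shows \<open>\<gamma>\<^sub>w \<le> max s (M + w[Z])\<close>.

  An optimal function for \<open>I\<close> may be supported on \<open>K \<union> Z\<close>: the value at a vertex
  \<open>i \<in> I - Z\<close> can be moved to a neighbour of \<open>i\<close> in \<open>K\<close>, whose closed neighbourhood contains
  that of \<open>i\<close> (\<open>concentrate_on_clique\<close>). On \<open>Z\<close> it may then be lowered to \<open>w\<close>, and on \<open>K\<close> raised at
  one arbitrary vertex until the total is \<open>max s (M + w[Z])\<close>. Now \<open>K\<close> carries at least \<open>M\<close>, and
  as every vertex of \<open>K\<close> sees all of \<open>K\<close>, the function dominates \<open>K\<close> too
  (\<open>min_dom_size_verts_upper\<close>).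

  Both terms of the maximum are bounded by costs of independent sets: \<open>s\<close> is the cost of
  \<open>I\<close>, and dominating the independent set \<open>{k} \<union> Z\<close> costs at least \<open>M + w[Z]\<close>, because its
  members have pairwise disjoint closed neighbourhoods (\<open>sum_weights_le_min_dom_size\<close>).
\<close>

section \<open>Minimal domination sizes\<close>

lemma min_dom_size_le:
  fixes f :: "'a \<Rightarrow> nat"
  assumes "w_dominates G w f U"
  shows "min_dom_size G w U \<le> sum f (verts G)"
  unfolding min_dom_size_def using assms by (intro Least_le) blast

lemma w_dominates_nat:
  fixes f :: "'a \<Rightarrow> nat"
  shows "w_dominates G w f U \<longleftrightarrow> (\<forall>u\<in>U. w u \<le> sum f (closed_nbhd G u))"
  by (simp add: w_dominates_def)

context graph
begin

lemma finite_closed_nbhd: "finite (closed_nbhd G u)"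
  by (simp add: closed_nbhd_def)

lemma min_dom_size_mono:
  assumes "U \<subseteq> W"
  shows "min_dom_size G w U \<le> min_dom_size G w W"
proof -
  obtain f :: "'a \<Rightarrow> nat"
    where "w_dominates G w f W" "sum f (verts G) = min_dom_size G w W"
    by (rule min_dom_size_attained)
  then show ?thesis
    using min_dom_size_le[of G w f U] assms by (auto simp: w_dominates_nat)
qed

section \<open>An upper bound for the weighted domination number\<close>

text \<open>
  In the next two lemmas \<open>Z\<close> is the set of those vertices of \<open>I\<close> that have no neighbour in
  \<open>K\<close>; by the independence of \<open>I\<close> they are isolated.
\<close>

lemma concentrate_on_clique:
  fixes f :: "'a \<Rightarrow> nat"
  assumes V: "verts G = K \<union> I"
    and I: "independent_set G I"
    and Z: "Z = {z \<in> I. \<forall>k\<in>K. \<not> z \<rightarrow> k}"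
    and dom: "w_dominates G w f I"
  obtains g :: "'a \<Rightarrow> nat"
  where "w_dominates G w g I" "sum g (K \<union> Z) = sum f (verts G)" "\<And>x. x \<notin> K \<union> Z \<Longrightarrow> g x = 0"
proof -
  have "\<forall>x\<in>verts G. \<exists>y\<in>K \<union> Z. y \<in> closed_nbhd G x \<and> (x \<in> K \<longrightarrow> y = x)"
    using V Z by (auto simp: closed_nbhd_def)
  then obtain p where p: "\<And>x. x \<in> verts G \<Longrightarrow> p x \<in> K \<union> Z"
      "\<And>x. x \<in> verts G \<Longrightarrow> p x \<in> closed_nbhd G x"
      "\<And>x. x \<in> verts G \<Longrightarrow> x \<in> K \<Longrightarrow> p x = x"
    by metis
  \<comment> \<open>The function \<open>g\<close> is the image of \<open>f\<close> under the retraction \<open>p\<close>, so \<open>g[A]\<close> is the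
    \<open>f\<close>-value of the preimage of \<open>A\<close>.\<close>
  define g where "g y = sum f {x \<in> verts G. p x = y}" for y
  have preimage: "sum g A = sum f {x \<in> verts G. p x \<in> A}" if "finite A" for A
  proof -
    have "sum f {x \<in> verts G. p x \<in> A}
        = (\<Sum>y\<in>A. sum f {x \<in> {x \<in> verts G. p x \<in> A}. p x = y})"
      using that by (intro sum.group[symmetric]) auto
    also have "\<dots> = sum g A"
      unfolding g_def by (intro sum.cong refl arg_cong2[where f = sum]) auto
    finally show ?thesis by simp
  qed
  have KZ: "finite (K \<union> Z)"
    using V Z by (intro finite_subset[OF _ finite_verts]) auto
  show thesis
  proof
    show "w_dominates G w g I"
      unfolding w_dominates_nat
    proof
      fix i assume i: "i \<in> I"
      have "p x \<in> closed_nbhd G i" if "x \<in> closed_nbhd G i" for x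
      proof (cases "x = i")
        case True
        then show ?thesis using p(2) i V by auto
      next
        case False
        then have "x \<in> verts G" "i \<rightarrow> x"
          using that by (auto simp: closed_nbhd_def)
        with i I V have "x \<in> K"
          by (auto simp: independent_set_def)
        with p(3) \<open>x \<in> verts G\<close> that show ?thesis by simp
      qed
      moreover have "closed_nbhd G i \<subseteq> verts G"
        using i V by (auto simp: closed_nbhd_def)
      ultimately have "sum f (closed_nbhd G i) \<le> sum g (closed_nbhd G i)"
        unfolding preimage[OF finite_closed_nbhd] by (intro sum_mono2) auto
      with dom i show "w i \<le> sum g (closed_nbhd G i)"
        by (force simp: w_dominates_nat)
    qed
    have "{x \<in> verts G. p x \<in> K \<union> Z} = verts G"
      using p(1) by auto
    then show "sum g (K \<union> Z) = sum f (verts G)"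
      using preimage[OF KZ] by simp
    show "g x = 0" if "x \<notin> K \<union> Z" for x
    proof -
      have "{y \<in> verts G. p y = x} = {}"
        using p(1) that by auto
      then show ?thesis by (simp only: g_def sum.empty)
    qed
  qed
qed

lemma min_dom_size_verts_upper:
  assumes V: "verts G = K \<union> I" and disj: "K \<inter> I = {}"
    and K: "clique G K" and I: "independent_set G I"
    and Z: "Z = {z \<in> I. \<forall>k\<in>K. \<not> z \<rightarrow> k}"
    and k0: "k0 \<in> K"
    and M: "\<And>k. k \<in> K \<Longrightarrow> w k \<le> M"
  shows "min_dom_size G w (verts G) \<le> max (min_dom_size G w I) (M + sum w Z)"
proof -
  define n where "n = max (min_dom_size G w I) (M + sum w Z)"
  obtain f :: "'a \<Rightarrow> nat"
    where f: "w_dominates G w f I" "sum f (verts G) = min_dom_size G w I"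
    by (rule min_dom_size_attained)
  obtain g :: "'a \<Rightarrow> nat"
    where g: "w_dominates G w g I" "sum g (K \<union> Z) = min_dom_size G w I"
      and g0: "\<And>x. x \<notin> K \<union> Z \<Longrightarrow> g x = 0"
    using concentrate_on_clique[OF V I Z f(1)] f(2) by metis
  have fin: "finite K" "finite Z"
    using V Z by (auto intro: finite_subset[OF _ finite_verts])
  have KZ: "K \<inter> Z = {}"
    using Z disj by auto
  have nbhd_Z: "closed_nbhd G z = {z}" if "z \<in> Z" for z
    using that Z V I by (auto simp: closed_nbhd_def independent_set_def)
  have wg: "w z \<le> g z" if "z \<in> Z" for z
  proof -
    have "w z \<le> sum g (closed_nbhd G z)"
      using g(1) that Z by (simp add: w_dominates_nat)
    then show ?thesis by (simp add: nbhd_Z[OF that])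
  qed
  have "sum g K + sum w Z \<le> sum g K + sum g Z"
    using wg by (simp add: sum_mono)
  also have "\<dots> \<le> n"
    using g(2) fin KZ by (simp add: sum.union_disjoint n_def)
  finally have le: "sum g K + sum w Z \<le> n" .
  define d where "d = n - (sum g K + sum w Z)"
  define h where "h x = (if x \<in> Z then w x else g x + (if x = k0 then d else 0))" for x
  have "sum h K = (\<Sum>x\<in>K. g x + (if x = k0 then d else 0))"
    using KZ by (intro sum.cong) (auto simp: h_def)
  also have "\<dots> = sum g K + d"
    using k0 fin by (simp add: sum.distrib)
  finally have hK: "sum h K + sum w Z = n"
    using le by (simp add: d_def)
  have hZ: "sum h Z = sum w Z"
    by (simp add: h_def)
  have "w u \<le> sum h (closed_nbhd G u)" if u: "u \<in> verts G" for u
  proof -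
    consider "u \<in> K" | "u \<in> Z" | "u \<in> I" "u \<notin> Z"
      using u V by auto
    then show ?thesis
    proof cases
      case 1
      then have "K \<subseteq> closed_nbhd G u"
        using K by (auto simp: clique_def closed_nbhd_def)
      then have "sum h K \<le> sum h (closed_nbhd G u)"
        by (intro sum_mono2 finite_closed_nbhd) auto
      moreover have "M \<le> sum h K"
        using hK by (simp add: n_def)
      ultimately show ?thesis
        using M[OF 1] by simp
    next
      case 2
      then show ?thesis by (simp add: nbhd_Z h_def)
    next
      case 3
      \<comment> \<open>The values on \<open>Z\<close>, which may have dropped, are not seen from \<open>u\<close>.\<close>
      have "x \<notin> Z" if "x \<in> closed_nbhd G u" for x
        using that 3 I Z by (auto simp: closed_nbhd_def independent_set_def)
      then have "sum g (closed_nbhd G u) \<le> sum h (closed_nbhd G u)"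
        by (intro sum_mono) (simp add: h_def)
      moreover have "w u \<le> sum g (closed_nbhd G u)"
        using g(1) 3 by (simp add: w_dominates_nat)
      ultimately show ?thesis by simp
    qed
  qed
  then have "w_dominates G w h (verts G)"
    by (simp add: w_dominates_nat)
  then have "min_dom_size G w (verts G) \<le> sum h (verts G)"
    by (rule min_dom_size_le)
  also have "sum h (verts G) = sum h (K \<union> Z)"
  proof (rule sum.mono_neutral_right)
    show "K \<union> Z \<subseteq> verts G"
      using V Z by auto
    show "\<forall>x\<in>verts G - (K \<union> Z). h x = 0"
    proof
      fix x assume "x \<in> verts G - (K \<union> Z)"
      then have "x \<noteq> k0" "x \<notin> Z" "g x = 0"
        using k0 g0 by blast+
      then show "h x = 0" by (simp add: h_def)
    qed
  qed simp
  also have "\<dots> = n"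
    using hK hZ fin KZ by (simp add: sum.union_disjoint)
  finally show ?thesis
    by (simp add: n_def)
qed

section \<open>Lower bounds from independent sets\<close>

lemma sum_weights_le_min_dom_size:
  assumes U: "U \<subseteq> verts G"
    and disj: "\<And>u v. u \<in> U \<Longrightarrow> v \<in> U \<Longrightarrow> u \<noteq> v \<Longrightarrow> closed_nbhd G u \<inter> closed_nbhd G v = {}"
  shows "sum w U \<le> min_dom_size G w U"
proof -
  obtain f :: "'a \<Rightarrow> nat"
    where f: "w_dominates G w f U" "sum f (verts G) = min_dom_size G w U"
    by (rule min_dom_size_attained)
  have "finite U"
    using U by (rule finite_subset) simp
  have "sum w U \<le> (\<Sum>u\<in>U. sum f (closed_nbhd G u))"
    using f(1) by (intro sum_mono) (simp add: w_dominates_nat)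
  also have "\<dots> = sum f (\<Union>u\<in>U. closed_nbhd G u)"
    using \<open>finite U\<close> disj finite_closed_nbhd by (intro sum.UNION_disjoint[symmetric]) auto
  also have "\<dots> \<le> sum f (verts G)"
    using U by (intro sum_mono2) (auto simp: closed_nbhd_def)
  finally show ?thesis
    using f(2) by simp
qed

lemma min_dom_size_le_independent_domination_number:
  assumes "independent_set G J"
  shows "min_dom_size G w J \<le> independent_domination_number G w"
  unfolding independent_domination_number_def
  using assms by (intro Max_ge finite_independent_sizes) blast

lemma independent_domination_number_le:
  "independent_domination_number G w \<le> weighted_domination_number G w"
  unfolding independent_domination_number_def weighted_domination_number_def
  using finite_independent_sizes independent_sizes_nonempty
  by (subst Max_le_iff) (auto simp: independent_set_def intro: min_dom_size_mono)

lemma weighted_domination_number_le: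
  assumes "split_graph G"
  shows "weighted_domination_number G w \<le> independent_domination_number G w"
proof -
  obtain K I where V: "verts G = K \<union> I" and disj: "K \<inter> I = {}"
    and K: "clique G K" and I: "independent_set G I"
    using assms by (auto simp: split_graph_def)
  show ?thesis
  proof (cases "K = {}")
    case True
    with V I show ?thesis
      using min_dom_size_le_independent_domination_number[OF I]
      by (simp add: weighted_domination_number_def)
  next
    case False
    define Z where "Z = {z \<in> I. \<forall>k\<in>K. \<not> z \<rightarrow> k}"
    have fin: "finite K" "finite Z"
      using V by (auto simp: Z_def intro: finite_subset[OF _ finite_verts])
    have "Max (w ` K) \<in> w ` K"
      using fin False by simp
    then obtain k where k: "k \<in> K" and Max_k: "Max (w ` K) = w k"
      by auto
    have M: "w k' \<le> w k" if "k' \<in> K" for k'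
      using that fin Max_k by (metis Max_ge finite_imageI imageI)
    have no_nbr: "\<not> z \<rightarrow> x" "\<not> x \<rightarrow> z" if "z \<in> Z" for z x
    proof -
      show "\<not> z \<rightarrow> x"
      proof
        assume "z \<rightarrow> x"
        then show False
          using that V I adj_in_verts(2)[of z x] by (auto simp: Z_def independent_set_def)
      qed
      then show "\<not> x \<rightarrow> z"
        using arcs_ends_symmetric[OF sym_arcs, of x z] by blast
    qed
    have ind: "independent_set G (insert k Z)"
      unfolding independent_set_def
    proof (intro conjI ballI)
      show "insert k Z \<subseteq> verts G"
        using k V by (auto simp: Z_def)
      show "\<not> u \<rightarrow> v" if "u \<in> insert k Z" "v \<in> insert k Z" for u v
        using that no_nbr adj_not_same[of k] by blast
    qed
    have "w k + sum w Z = sum w (insert k Z)"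
      using fin k disj by (subst sum.insert) (auto simp: Z_def)
    also have "\<dots> \<le> min_dom_size G w (insert k Z)"
      using no_nbr ind
      by (intro sum_weights_le_min_dom_size) (auto simp: closed_nbhd_def independent_set_def)
    also have "\<dots> \<le> independent_domination_number G w"
      by (rule min_dom_size_le_independent_domination_number[OF ind])
    finally have "w k + sum w Z \<le> independent_domination_number G w" .
    moreover have "min_dom_size G w (verts G) \<le> max (min_dom_size G w I) (w k + sum w Z)"
      by (rule min_dom_size_verts_upper[OF V disj K I Z_def k M])
    ultimately show ?thesis
      using min_dom_size_le_independent_domination_number[OF I, of w]
      by (simp add: weighted_domination_number_def)
  qed
qed

end

theorem theorem5p2:
  fixes G :: "('a, 'b) pre_digraph" and w :: "'a \<Rightarrow> nat"
  assumes "graph G" and "split_graph G"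
  shows "weighted_domination_number G w = independent_domination_number G w"
  using graph.weighted_domination_number_le[OF assms]
    graph.independent_domination_number_le[OF assms(1)]
  by (rule antisym)

end
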